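(* Let $V_{\mathbb H}^R\neq\{0\}$ be a separable right quaternionic Hilbert space and let $A\in\mathcal B(V_{\mathbb H}^R)$. Then the approximate $S$-point spectrum $\sigma_{ap}^S(A)$ is a non-empty closed subset of $\mathbb H$, and $\partial\sigma_S(A)\subseteq\sigma_{ap}^S(A)$, where $\partial\sigma_S(A)$ is the boundary of $\sigma_S(A)$ in $\mathbb H$.
   Context: $\mathbb H$ denotes the quaternions with the usual norm $|\cdot|$ (topologically $\mathbb R^4$); for $\mathfrak q=q_0+q_1\mathbf i+q_2\mathbf j+q_3\mathbf k$, $\mathrm{Re}(\mathfrak q)=q_0$. A right quaternionic Hilbert space is a right $\mathbb H$-vector space, complete for the norm of an $\mathbb H$-valued inner product $\langle\cdot|\cdot\rangle$ satisfying $\overline{\langle\phi|\psi\rangle}=\langle\psi|\phi\rangle$, $\|\phi\|^2=\langle\phi|\phi\rangle>0$ for $\phi\ne0$, additivity, $\langle\phi|\psi\mathfrak q\rangle=\langle\phi|\psi\rangle\mathfrak q$ and $\langle\phi\mathfrak q|\psi\rangle=\overline{\mathfrak q}\langle\phi|\psi\rangle$. $\mathcal B(V_{\mathbb H}^R)$ is the set of bounded right $\mathbb H$-linear operators $V_{\mathbb H}^R\to V_{\mathbb H}^R$, and $\mathbb I$ is the identity operator. For $\mathfrak q\in\mathbb H$, $R_{\mathfrak q}(A)=A^2-2\,\mathrm{Re}(\mathfrak q)A+|\mathfrak q|^2\mathbb I$. The $S$-spectrum is $\sigma_S(A)=\{\mathfrak q\in\mathbb H: R_{\mathfrak q}(A)\text{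 has no inverse in }\mathcal B(V_{\mathbb H}^R)\}$. The approximate $S$-point spectrum is $\sigma_{ap}^S(A)=\{\mathfrak q\in\mathbb H:\text{there is a sequence }(\phi_n)_{n\ge1}\text{ in }V_{\mathbb H}^R\text{ with }\|\phi_n\|=1\text{ for all }n\text{ and }\|R_{\mathfrak q}(A)\phi_n\|\to0\}$. *)

theory Defs
  imports "HOL-Analysis.Analysis"
begin

section \<open>Quaternions\<close>

codatatype quat = Quat (qRe: real) (qIm1: real) (qIm2: real) (qIm3: real)

lemma quat_eqI: "qRe x = qRe y \<Longrightarrow> qIm1 x = qIm1 y \<Longrightarrow> qIm2 x = qIm2 y \<Longrightarrow> qIm3 x = qIm3 y \<Longrightarrow> x = y"
  by (rule quat.expand) simp

lemma quat_eq_iff: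
  "x = y \<longleftrightarrow> qRe x = qRe y \<and> qIm1 x = qIm1 y \<and> qIm2 x = qIm2 y \<and> qIm3 x = qIm3 y"
  by (auto intro: quat_eqI)

instantiation quat :: ab_group_add
begin

primcorec zero_quat where
  "qRe 0 = 0" | "qIm1 0 = 0" | "qIm2 0 = 0" | "qIm3 0 = 0"

primcorec plus_quat where
  "qRe (x + y) = qRe x + qRe y"
| "qIm1 (x + y) = qIm1 x + qIm1 y"
| "qIm2 (x + y) = qIm2 x + qIm2 y"
| "qIm3 (x + y) = qIm3 x + qIm3 y"

primcorec uminus_quat where
  "qRe (- x) = - qRe x"
| "qIm1 (- x) = - qIm1 x"
| "qIm2 (- x) = - qIm2 x"
| "qIm3 (- x) = - qIm3 x"

primcorec minus_quat where
  "qRe (x - y) = qRe x - qRe y"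
| "qIm1 (x - y) = qIm1 x - qIm1 y"
| "qIm2 (x - y) = qIm2 x - qIm2 y"
| "qIm3 (x - y) = qIm3 x - qIm3 y"

instance
  by standard (simp_all add: quat_eq_iff)

end

instantiation quat :: real_algebra_1
begin

primcorec one_quat where
  "qRe 1 = 1" | "qIm1 1 = 0" | "qIm2 1 = 0" | "qIm3 1 = 0"

primcorec times_quat where
  "qRe (x * y) = qRe x * qRe y - qIm1 x * qIm1 y - qIm2 x * qIm2 y - qIm3 x * qIm3 y"
| "qIm1 (x * y) = qRe x * qIm1 y + qIm1 x * qRe y + qIm2 x * qIm3 y - qIm3 x * qIm2 y"
| "qIm2 (x * y) = qRe x * qIm2 y - qIm1 x * qIm3 y + qIm2 x * qRe y + qIm3 x * qIm1 y"
| "qIm3 (x * y) = qRe x * qIm3 y + qIm1 x * qIm2 y - qIm2 x * qIm1 y + qIm3 x * qRe y"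

primcorec scaleR_quat where
  "qRe (scaleR r x) = r * qRe x"
| "qIm1 (scaleR r x) = r * qIm1 x"
| "qIm2 (scaleR r x) = r * qIm2 x"
| "qIm3 (scaleR r x) = r * qIm3 x"

instance
  by standard (simp_all add: quat_eq_iff algebra_simps)

end

primcorec qcnj :: "quat \<Rightarrow> quat" where
  "qRe (qcnj x) = qRe x"
| "qIm1 (qcnj x) = - qIm1 x"
| "qIm2 (qcnj x) = - qIm2 x"
| "qIm3 (qcnj x) = - qIm3 x"

instantiation quat :: real_inner
begin

definition inner_quat :: "quat \<Rightarrow> quat \<Rightarrow> real" where
  "inner_quat x y = qRe x * qRe y + qIm1 x * qIm1 y + qIm2 x * qIm2 y + qIm3 x * qIm3 y"

definition norm_quat :: "quat \<Rightarrow> real" where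
  "norm_quat x = sqrt ((qRe x)\<^sup>2 + (qIm1 x)\<^sup>2 + (qIm2 x)\<^sup>2 + (qIm3 x)\<^sup>2)"

definition sgn_quat :: "quat \<Rightarrow> quat" where
  "sgn_quat x = x /\<^sub>R norm x"

definition dist_quat :: "quat \<Rightarrow> quat \<Rightarrow> real" where
  "dist_quat x y = norm (x - y)"

definition uniformity_quat :: "(quat \<times> quat) filter" where
  "uniformity_quat = (INF e\<in>{0 <..}. principal {(x, y). dist x y < e})"

definition open_quat :: "quat set \<Rightarrow> bool" where
  "open_quat U \<longleftrightarrow> (\<forall>x\<in>U. eventually (\<lambda>(x', y). x' = x \<longrightarrow> y \<in> U) uniformity)"

instance
proof
  fix x y z :: quat and r :: real and U :: "quat set"
  show "inner x x = 0 \<longleftrightarrow> x = 0"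
    by (auto simp: inner_quat_def quat_eq_iff add_nonneg_eq_0_iff)
  show "norm x = sqrt (inner x x)"
    by (simp add: norm_quat_def inner_quat_def power2_eq_square)
  show "inner x y = inner y x" "inner (x + y) z = inner x z + inner y z"
    "inner (r *\<^sub>R x) y = r * inner x y" "0 \<le> inner x x"
    by (simp_all add: inner_quat_def algebra_simps)
qed (rule sgn_quat_def dist_quat_def uniformity_quat_def open_quat_def)+

end

lemma norm_quat_power2: "(norm (x::quat))\<^sup>2 = (qRe x)\<^sup>2 + (qIm1 x)\<^sup>2 + (qIm2 x)\<^sup>2 + (qIm3 x)\<^sup>2"
  by (simp add: norm_quat_def)

lemma qcnj_mult_self: "qcnj x * x = of_real ((norm x)\<^sup>2)"
  unfolding norm_quat_power2 of_real_def
  by (simp add: quat_eq_iff power2_eq_square algebra_simps)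

lemma mult_qcnj_self: "x * qcnj x = of_real ((norm x)\<^sup>2)"
  unfolding norm_quat_power2 of_real_def
  by (simp add: quat_eq_iff power2_eq_square algebra_simps)

instantiation quat :: real_normed_div_algebra
begin

definition inverse_quat :: "quat \<Rightarrow> quat" where
  "inverse_quat x = qcnj x /\<^sub>R (norm x)\<^sup>2"

definition divide_quat :: "quat \<Rightarrow> quat \<Rightarrow> quat" where
  "divide_quat x y = x * inverse y"

instance
proof
  fix x y :: quat
  show "inverse x * x = 1" if "x \<noteq> 0"
    using that by (simp add: inverse_quat_def qcnj_mult_self of_real_def)
  show "x * inverse x = 1" if "x \<noteq> 0"
    using that by (simp add: inverse_quat_def mult_qcnj_self of_real_def)
  show "x div y = x * inverse y"
    by (simp add: divide_quat_def)
  show "inverse (0::quat) = 0"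
    by (simp add: inverse_quat_def)
  have "(norm (x * y))\<^sup>2 = (norm x * norm y)\<^sup>2"
    unfolding power_mult_distrib norm_quat_power2 times_quat.sel by algebra
  then show "norm (x * y) = norm x * norm y"
    by (rule power2_eq_imp_eq) simp_all
qed

end

instantiation quat :: euclidean_space
begin

definition Basis_quat :: "quat set" where
  "Basis_quat = {Quat 1 0 0 0, Quat 0 1 0 0, Quat 0 0 1 0, Quat 0 0 0 1}"

instance
proof
  fix u v x :: quat
  show "Basis \<noteq> ({}::quat set)" "finite (Basis::quat set)"
    by (simp_all add: Basis_quat_def)
  show "inner u v = (if u = v then 1 else 0)" if "u \<in> Basis" "v \<in> Basis"
    using that unfolding Basis_quat_def
    by (elim insertE emptyE; hypsubst; simp add: inner_quat_def)
  show "(\<forall>u\<in>Basis. inner x u = 0) \<longleftrightarrow> x = 0"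
    unfolding Basis_quat_def ball_simps inner_quat_def quat_eq_iff[of x] by simp
qed

end


section \<open>Right quaternionic Hilbert spaces\<close>

text \<open>
  The real scalar multiplication and the norm inherited from \<^class>\<open>banach\<close> carry no additional
  data: they are pinned down by \<open>scaleR_eq_qscale\<close> and \<open>qinner_self\<close>.  In particular the triangle
  inequality required by \<^class>\<open>banach\<close> is the one that follows from the Cauchy--Schwarz
  inequality.
\<close>

class right_quat_hilbert = banach +
  fixes qscale :: "'a \<Rightarrow> quat \<Rightarrow> 'a" (infixl "\<cdot>\<^sub>q" 75)
    and qinner :: "'a \<Rightarrow> 'a \<Rightarrow> quat"
  assumes qscale_add_left: "(x + y) \<cdot>\<^sub>q p = x \<cdot>\<^sub>q p + y \<cdot>\<^sub>q p"
    and qscale_add_right: "x \<cdot>\<^sub>q (p + q) = x \<cdot>\<^sub>q p + x \<cdot>\<^sub>q q"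
    and qscale_qscale: "x \<cdot>\<^sub>q p \<cdot>\<^sub>q q = x \<cdot>\<^sub>q (p * q)"
    and qscale_one: "x \<cdot>\<^sub>q 1 = x"
    and scaleR_eq_qscale: "r *\<^sub>R x = x \<cdot>\<^sub>q of_real r"
    and qcnj_qinner: "qcnj (qinner x y) = qinner y x"
    and qinner_self: "qinner x x = of_real ((norm x)\<^sup>2)"
    and qinner_add_left: "qinner (x + y) z = qinner x z + qinner y z"
    and qinner_add_right: "qinner x (y + z) = qinner x y + qinner x z"
    and qinner_qscale_right: "qinner x (y \<cdot>\<^sub>q p) = qinner x y * p"
    and qinner_qscale_left: "qinner (x \<cdot>\<^sub>q p) y = qcnj p * qinner x y"

instantiation quat :: right_quat_hilbert
begin

definition qscale_quat :: "quat \<Rightarrow> quat \<Rightarrow> quat" where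
  "qscale_quat x p = x * p"

definition qinner_quat :: "quat \<Rightarrow> quat \<Rightarrow> quat" where
  "qinner_quat x y = qcnj x * y"

instance
proof
  fix r :: real and x :: quat
  show "r *\<^sub>R x = x \<cdot>\<^sub>q of_real r"
    by (simp add: qscale_quat_def of_real_def)
  show "qinner x x = of_real ((norm x)\<^sup>2)"
    by (simp only: qinner_quat_def qcnj_mult_self)
qed (simp_all add: qscale_quat_def qinner_quat_def quat_eq_iff algebra_simps)

end


section \<open>Bounded right linear operators and their S-spectra\<close>

locale bounded_right_linear = bounded_linear A
  for A :: "'v::right_quat_hilbert \<Rightarrow> 'v" +
  assumes qscale: "A (x \<cdot>\<^sub>q p) = A x \<cdot>\<^sub>q p"

definition S_resolvent_poly :: "quat \<Rightarrow> ('v \<Rightarrow> 'v) \<Rightarrow> 'v \<Rightarrow> 'v::right_quat_hilbert" where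
  "S_resolvent_poly q A = (\<lambda>x. A (A x) - (2 * qRe q) *\<^sub>R A x + (norm q)\<^sup>2 *\<^sub>R x)"

definition S_spectrum :: "('v \<Rightarrow> 'v::right_quat_hilbert) \<Rightarrow> quat set" where
  "S_spectrum A = {q. \<not> (\<exists>B. bounded_right_linear B \<and>
      B \<circ> S_resolvent_poly q A = id \<and> S_resolvent_poly q A \<circ> B = id)}"

definition approx_S_point_spectrum :: "('v \<Rightarrow> 'v::right_quat_hilbert) \<Rightarrow> quat set" where
  "approx_S_point_spectrum A = {q. \<exists>\<phi> :: nat \<Rightarrow> 'v.
      (\<forall>n. norm (\<phi> n) = 1) \<and> (\<lambda>n. norm (S_resolvent_poly q A (\<phi> n))) \<longlonglongrightarrow> 0}"

end

theory Submission
  imports Defs "HOL-Complex_Analysis.Complex_Analysis"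
begin

text \<open>
  Call an operator bounded below if \<open>c * norm x \<le> norm (T x)\<close> for some \<open>c > 0\<close> and all \<open>x\<close>.  By
  normalising vectors, \<open>q\<close> lies outside the approximate S-point spectrum exactly when
  \<open>R\<^sub>q(A) = A\<^sup>2 - 2 Re(q) A + |q|\<^sup>2\<close> is bounded below
  (\<open>not_in_approx_S_point_spectrum_iff\<close>), and \<open>q\<close> lies outside the S-spectrum exactly when
  \<open>R\<^sub>q(A)\<close> is bounded below and surjective.  Since \<open>R\<^sub>q(A)\<close> depends norm-continuously on \<open>q\<close>
  and being bounded below survives small perturbations, the approximate S-point spectrum is
  closed.

  Surjectivity also survives perturbations smaller than the lower bound
  (\<open>surj_perturbation\<close>, a contraction argument).  Suppose \<open>R\<^sub>q(A)\<close> is bounded below.  Then the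
  operators \<open>R\<^sub>p(A)\<close> with \<open>p\<close> near \<open>q\<close> are bounded below by a common constant and lie close to
  each other, so either all of them or none of them are surjective; hence \<open>q\<close> is not a boundary
  point of the S-spectrum (\<open>frontier_S_spectrum_subset\<close>).

  The approximate S-point spectrum is therefore non-empty as soon as the S-spectrum has a
  boundary point, that is, as soon as it is neither empty nor all of the quaternions.  It is not
  everything, because \<open>R\<^sub>r(A)\<close> is a small perturbation of \<open>r\<^sup>2\<close> for large real \<open>r\<close>.  That it is
  not empty (\<open>S_spectrum_nonempty\<close>) is reduced to complex analysis: multiplication by complex
  numbers from the right makes the space a complex Hilbert space on which
  \<open>R\<^sub>z(A) = (A - z)(A - cnj z)\<close> for complex \<open>z\<close>.  If the S-spectrum were empty, every \<open>A - z\<close>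
  would be invertible, and the matrix coefficients of its inverse would be entire functions that
  vanish at infinity, hence zero by Liouville's theorem, which is absurd.
\<close>

section \<open>Norm and inner product of a right quaternionic Hilbert space\<close>

lemma norm_qscale: "norm (x \<cdot>\<^sub>q p) = norm x * norm p"
proof -
  have "of_real ((norm (x \<cdot>\<^sub>q p))\<^sup>2) = qcnj p * (qinner x x * p)"
    by (metis qinner_self qinner_qscale_left qinner_qscale_right)
  also have "\<dots> = of_real ((norm x)\<^sup>2) * (qcnj p * p)"
    by (simp add: qinner_self of_real_def)
  also have "\<dots> = of_real ((norm x * norm p)\<^sup>2)"
    by (simp add: qcnj_mult_self power_mult_distrib)
  finally have "(norm (x \<cdot>\<^sub>q p))\<^sup>2 = (norm x * norm p)\<^sup>2"
    by (simp only: of_real_eq_iff)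
  then show ?thesis
    by (rule power2_eq_imp_eq) simp_all
qed

lemma qscale_minus_right: "x \<cdot>\<^sub>q (p - q) = x \<cdot>\<^sub>q p - x \<cdot>\<^sub>q q"
  by (metis add_diff_cancel_right' diff_add_cancel qscale_add_right)

lemma qscale_minus_left: "(x - y) \<cdot>\<^sub>q p = x \<cdot>\<^sub>q p - y \<cdot>\<^sub>q p"
  by (metis add_diff_cancel_right' diff_add_cancel qscale_add_left)

lemma of_real_mult_commute_quat: "of_real r * (p::quat) = p * of_real r"
  by (simp add: of_real_def)

lemma bounded_linear_qscale: "bounded_linear (\<lambda>x. x \<cdot>\<^sub>q p)"
proof (rule bounded_linear_intro)
  show "(r *\<^sub>R x) \<cdot>\<^sub>q p = r *\<^sub>R (x \<cdot>\<^sub>q p)" for r x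
    by (simp add: scaleR_eq_qscale qscale_qscale of_real_mult_commute_quat)
  show "norm (x \<cdot>\<^sub>q p) \<le> norm x * norm p" for x
    by (simp add: norm_qscale)
qed (rule qscale_add_left)

text \<open>
  The triangle inequality is part of the assumed Banach space structure; expanding
  \<open>norm (x + y)\<^sup>2\<close> turns it into the real form of the Cauchy--Schwarz inequality.
\<close>

lemma qRe_qinner_le: "qRe (qinner x y) \<le> norm x * norm y"
proof -
  have qRe_of_real: "qRe (of_real r) = r" for r
    by (simp add: of_real_def)
  have "qRe (qinner y x) = qRe (qinner x y)"
    by (metis qcnj_qinner qcnj.sel(1))
  then have "(norm (x + y))\<^sup>2 = (norm x)\<^sup>2 + 2 * qRe (qinner x y) + (norm y)\<^sup>2"
    using arg_cong[OF qinner_self[of "x + y"], of qRe]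
      arg_cong[OF qinner_self[of x], of qRe] arg_cong[OF qinner_self[of y], of qRe]
    unfolding qRe_of_real by (simp add: qinner_add_left qinner_add_right)
  moreover have "(norm (x + y))\<^sup>2 \<le> (norm x + norm y)\<^sup>2"
    by (intro power_mono norm_triangle_ineq) simp
  ultimately show ?thesis
    by (simp add: power2_sum)
qed

lemma norm_qcnj: "norm (qcnj p) = norm p"
  by (simp add: norm_quat_def)

text \<open>
  The quaternionic Cauchy--Schwarz inequality follows from the real one by rotating \<open>y\<close> with the
  conjugate of \<open>qinner x y\<close>, which makes the inner product real.
\<close>

lemma norm_qinner_le: "norm (qinner x y) \<le> norm x * norm y"
proof (cases "qinner x y = 0")
  case False
  let ?p = "qinner x y"
  have "(norm ?p)\<^sup>2 = qRe (qinner x (y \<cdot>\<^sub>q qcnj ?p))"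
    by (simp add: qinner_qscale_right mult_qcnj_self) (simp add: of_real_def)
  also have "\<dots> \<le> norm x * norm y * norm ?p"
    using qRe_qinner_le[of x "y \<cdot>\<^sub>q qcnj ?p"] by (simp add: norm_qscale norm_qcnj)
  finally show ?thesis
    using False by (simp add: power2_eq_square)
qed simp

lemma bounded_linear_qinner: "bounded_linear (qinner x)"
proof (rule bounded_linear_intro)
  show "qinner x (r *\<^sub>R y) = r *\<^sub>R qinner x y" for r y
    unfolding scaleR_eq_qscale[of r y] qinner_qscale_right by (simp add: of_real_def)
  show "norm (qinner x y) \<le> norm y * norm x" for y
    by (metis norm_qinner_le mult.commute)
qed (rule qinner_add_right)

lemma bounded_linear_qRe: "bounded_linear qRe"
proof (rule bounded_linear_intro)
  show "norm (qRe p) \<le> norm p * 1" for p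
    by (simp add: norm_quat_def real_le_rsqrt)
qed simp_all

section \<open>Operators that are bounded below\<close>

text \<open>
  To solve \<open>S x = y\<close>, rewrite it as \<open>T x = y - (S x - T x)\<close>.  Applying \<open>T\<^sup>-\<^sup>1\<close>, which has
  norm at most \<open>1 / c\<close>, gives a fixed point equation for a contraction with factor \<open>d / c\<close>.
\<close>

lemma surj_perturbation:
  fixes S T :: "'a::banach \<Rightarrow> 'b::real_normed_vector"
  assumes "linear S" "linear T" "surj T"
    and below: "\<And>x. c * norm x \<le> norm (T x)"
    and close: "\<And>x. norm (S x - T x) \<le> d * norm x"
    and d: "0 \<le> d" "d < c"
  shows "surj S"
proof -
  interpret S: linear S by fact
  interpret T: linear T by fact
  have T_inv: "T (inv T u) = u" for u
    by (rule surj_f_inv_f[OF \<open>surj T\<close>])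
  have "\<exists>x. S x = y" for y
  proof -
    let ?F = "\<lambda>x. inv T (y - (S x - T x))"
    have "\<exists>!x. ?F x = x"
    proof (rule banach_fix_type, safe)
      show "0 \<le> d / c" "d / c < 1"
        using d by simp_all
      show "dist (?F u) (?F v) \<le> d / c * dist u v" for u v
      proof -
        have "T (?F u - ?F v) = (S (v - u) - T (v - u))"
          by (simp add: T.diff T_inv S.diff)
        then have "c * norm (?F u - ?F v) \<le> d * norm (v - u)"
          by (metis below close order_trans)
        then show ?thesis
          using d by (simp add: dist_norm norm_minus_commute field_simps)
      qed
    qed
    then obtain x where "?F x = x" by auto
    then have "T x = y - (S x - T x)"
      by (metis T_inv)
    then show ?thesis by auto
  qed
  then show ?thesis by (metis surjI)
qed

lemma bounded_below_perturbation:
  fixes S T :: "'a::real_normed_vector \<Rightarrow> 'b::real_normed_vector"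
  assumes "c * norm x \<le> norm (T x)" "norm (S x - T x) \<le> d * norm x"
  shows "(c - d) * norm x \<le> norm (S x)"
  using assms norm_triangle_ineq3[of "S x" "T x"] by (simp add: algebra_simps)

lemma bounded_below_inj:
  assumes "linear T" "c > 0" and below: "\<And>x. c * norm x \<le> norm (T x)"
  shows "inj T"
proof -
  have "x = 0" if "T x = 0" for x
    using below[of x] that \<open>c > 0\<close> by (simp add: mult_le_0_iff)
  then show ?thesis
    by (simp add: linear_injective_0[OF \<open>linear T\<close>])
qed

lemma bounded_right_linear_inverse:
  fixes T :: "'v::right_quat_hilbert \<Rightarrow> 'v"
  assumes "bounded_right_linear T" "surj T" "c > 0" and below: "\<And>x. c * norm x \<le> norm (T x)"
  shows "\<exists>B. bounded_right_linear B \<and> B \<circ> T = id \<and> T \<circ> B = id"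
proof (intro exI conjI)
  interpret T: bounded_right_linear T by fact
  have inj: "inj T"
    using bounded_below_inj[OF T.linear_axioms \<open>c > 0\<close> below] .
  have T_inv: "T (inv T u) = u" for u
    by (rule surj_f_inv_f[OF \<open>surj T\<close>])
  show "inv T \<circ> T = id" "T \<circ> inv T = id"
    using inj \<open>surj T\<close> by (simp_all add: surj_iff)
  show "bounded_right_linear (inv T)"
  proof (intro bounded_right_linear.intro bounded_right_linear_axioms.intro
      bounded_linear_intro[where K = "1 / c"])
    show "inv T (x + y) = inv T x + inv T y" for x y
      by (rule injD[OF inj]) (simp add: T.add T_inv)
    show "inv T (r *\<^sub>R x) = r *\<^sub>R inv T x" for r x
      by (rule injD[OF inj]) (simp add: T.scaleR T_inv)
    show "inv T (x \<cdot>\<^sub>q p) = inv T x \<cdot>\<^sub>q p" for x p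
      by (rule injD[OF inj]) (simp add: T.qscale T_inv)
    show "norm (inv T x) \<le> norm x * (1 / c)" for x
      using below[of "inv T x"] \<open>c > 0\<close> by (simp add: T_inv field_simps)
  qed
qed

section \<open>The approximate S-point spectrum and the boundary of the S-spectrum\<close>

lemma bounded_right_linear_S_resolvent_poly:
  assumes "bounded_right_linear A"
  shows "bounded_right_linear (S_resolvent_poly q A)"
proof -
  interpret A: bounded_right_linear A by fact
  have scale: "(r *\<^sub>R x) \<cdot>\<^sub>q p = r *\<^sub>R (x \<cdot>\<^sub>q p)" for r p and x :: 'a
    by (rule linear_scale[OF bounded_linear.linear[OF bounded_linear_qscale]])
  show ?thesis
  proof (intro bounded_right_linear.intro bounded_right_linear_axioms.intro)
    show "bounded_linear (S_resolvent_poly q A)"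
      unfolding S_resolvent_poly_def
      by (intro bounded_linear_add bounded_linear_sub bounded_linear_ident
          bounded_linear_const_scaleR A.bounded_linear_axioms
          bounded_linear_compose[OF A.bounded_linear_axioms])
    show "S_resolvent_poly q A (x \<cdot>\<^sub>q p) = S_resolvent_poly q A x \<cdot>\<^sub>q p" for x p
      by (simp add: S_resolvent_poly_def A.qscale qscale_add_left qscale_minus_left scale)
  qed
qed

text \<open>
  Norm continuity of \<open>q \<mapsto> R\<^sub>q(A)\<close>, phrased with an explicit bound on vectors so that it can be
  fed directly into the two perturbation lemmas.
\<close>

lemma S_resolvent_poly_continuous:
  assumes "bounded_right_linear A" "e > 0"
  shows "\<forall>\<^sub>F p in nhds q. \<forall>x. norm (S_resolvent_poly p A x - S_resolvent_poly q A x) \<le> e * norm x"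
proof -
  interpret A: bounded_right_linear A by fact
  obtain K where K: "norm (A x) \<le> norm x * K" for x
    using A.bounded by blast
  let ?m = "\<lambda>p. \<bar>2 * qRe p - 2 * qRe q\<bar> * K + \<bar>(norm p)\<^sup>2 - (norm q)\<^sup>2\<bar>"
  have "(?m \<longlongrightarrow> ?m q) (nhds q)"
    by (intro tendsto_intros bounded_linear.tendsto[OF bounded_linear_qRe] filterlim_ident)
  then have "\<forall>\<^sub>F p in nhds q. ?m p < e"
    using \<open>e > 0\<close> by (intro order_tendstoD(2)[where y = "?m q"]) simp_all
  then show ?thesis
  proof (rule eventually_mono, intro allI)
    fix p x assume m: "?m p < e"
    have "S_resolvent_poly p A x - S_resolvent_poly q A x =
        ((norm p)\<^sup>2 - (norm q)\<^sup>2) *\<^sub>R x - (2 * qRe p - 2 * qRe q) *\<^sub>R A x"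
      by (simp add: S_resolvent_poly_def algebra_simps)
    then have "norm (S_resolvent_poly p A x - S_resolvent_poly q A x) \<le>
        \<bar>(norm p)\<^sup>2 - (norm q)\<^sup>2\<bar> * norm x + \<bar>2 * qRe p - 2 * qRe q\<bar> * norm (A x)"
      by (metis norm_scaleR norm_triangle_ineq4)
    also have "\<dots> \<le> \<bar>(norm p)\<^sup>2 - (norm q)\<^sup>2\<bar> * norm x + \<bar>2 * qRe p - 2 * qRe q\<bar> * (norm x * K)"
      by (intro add_left_mono mult_left_mono K) simp
    also have "\<dots> = ?m p * norm x"
      by (simp add: algebra_simps)
    also have "\<dots> \<le> e * norm x"
      using m by (intro mult_right_mono) simp_all
    finally show "norm (S_resolvent_poly p A x - S_resolvent_poly q A x) \<le> e * norm x" .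
  qed
qed

text \<open>
  If no positive lower bound exists, then \<open>1 / (n + 1)\<close> fails for each \<open>n\<close>, and normalising a
  vector at which it fails gives the \<open>n\<close>-th member of an approximating sequence.
\<close>

lemma not_in_approx_S_point_spectrum_iff:
  assumes "bounded_right_linear A"
  shows "q \<notin> approx_S_point_spectrum A \<longleftrightarrow>
    (\<exists>c>0. \<forall>x. c * norm x \<le> norm (S_resolvent_poly q A x))"
proof
  interpret R: bounded_right_linear "S_resolvent_poly q A"
    by (rule bounded_right_linear_S_resolvent_poly) fact
  let ?R = "S_resolvent_poly q A"
  show "q \<notin> approx_S_point_spectrum A"
    if "\<exists>c>0. \<forall>x. c * norm x \<le> norm (?R x)"
  proof
    from that obtain c where c: "c > 0" "\<And>x. c * norm x \<le> norm (?R x)" by blast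
    assume "q \<in> approx_S_point_spectrum A"
    then obtain \<phi> :: "nat \<Rightarrow> 'a" where \<phi>: "\<And>n. norm (\<phi> n) = 1" "(\<lambda>n. norm (?R (\<phi> n))) \<longlonglongrightarrow> 0"
      unfolding approx_S_point_spectrum_def by blast
    have "c \<le> norm (?R (\<phi> n))" for n
      using c(2)[of "\<phi> n"] by (simp add: \<phi>)
    then have "c \<le> 0"
      by (intro LIMSEQ_le_const[OF \<phi>(2)]) blast
    then show False using c by simp
  qed
  show "\<exists>c>0. \<forall>x. c * norm x \<le> norm (?R x)" if "q \<notin> approx_S_point_spectrum A"
  proof (rule ccontr)
    assume no: "\<not> ?thesis"
    have "\<exists>u. norm u = 1 \<and> norm (?R u) < 1 / Suc n" for n
    proof -
      obtain x where x: "norm (?R x) < 1 / Suc n * norm x"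
        using no by (metis not_le zero_less_divide_1_iff of_nat_0_less_iff zero_less_Suc)
      then have "x \<noteq> 0" by auto
      with x show ?thesis
        by (intro exI[of _ "x /\<^sub>R norm x"]) (simp add: R.scaleR field_simps)
    qed
    then obtain \<phi> where \<phi>: "\<And>n. norm (\<phi> n) = 1" "\<And>n. norm (?R (\<phi> n)) < 1 / Suc n"
      by metis
    have "(\<lambda>n. norm (?R (\<phi> n))) \<longlonglongrightarrow> 0"
      using \<phi>(2)
      by (intro Lim_null_comparison[OF _ LIMSEQ_inverse_real_of_nat] always_eventually)
        (simp add: inverse_eq_divide less_imp_le)
    with \<phi>(1) that show False
      unfolding approx_S_point_spectrum_def by blast
  qed
qed

lemma closed_approx_S_point_spectrum:
  assumes A: "bounded_right_linear A"
  shows "closed (approx_S_point_spectrum A)"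
proof -
  have "\<forall>\<^sub>F p in nhds q. p \<in> - approx_S_point_spectrum A"
    if "q \<in> - approx_S_point_spectrum A" for q
  proof -
    from that obtain c where c: "c > 0" "\<And>x. c * norm x \<le> norm (S_resolvent_poly q A x)"
      using not_in_approx_S_point_spectrum_iff[OF A] by auto
    have "\<forall>\<^sub>F p in nhds q. \<forall>x. norm (S_resolvent_poly p A x - S_resolvent_poly q A x) \<le> c / 2 * norm x"
      using c by (intro S_resolvent_poly_continuous A) simp
    then show ?thesis
    proof (rule eventually_mono)
      fix p assume "\<forall>x. norm (S_resolvent_poly p A x - S_resolvent_poly q A x) \<le> c / 2 * norm x"
      then have "(c - c / 2) * norm x \<le> norm (S_resolvent_poly p A x)" for x
        using c(2) bounded_below_perturbation by blast
      then show "p \<in> - approx_S_point_spectrum A"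
        using c(1) not_in_approx_S_point_spectrum_iff[OF A]
        by (metis ComplI half_gt_zero field_sum_of_halves add_diff_cancel)
    qed
  qed
  then show ?thesis
    unfolding closed_def eventually_nhds by (subst open_subopen) blast
qed

lemma not_in_S_spectrumI:
  assumes "bounded_right_linear A" "surj (S_resolvent_poly q A)" "c > 0"
    and "\<And>x. c * norm x \<le> norm (S_resolvent_poly q A x)"
  shows "q \<notin> S_spectrum A"
  using bounded_right_linear_inverse[OF bounded_right_linear_S_resolvent_poly[OF assms(1)] assms(2-4)]
  unfolding S_spectrum_def by blast

lemma not_in_S_spectrumD:
  assumes "q \<notin> S_spectrum A"
  shows "surj (S_resolvent_poly q A)"
    and "\<exists>c>0. \<forall>x. c * norm x \<le> norm (S_resolvent_poly q A x)"
proof -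
  from assms obtain B where B: "bounded_right_linear B"
      "B \<circ> S_resolvent_poly q A = id" "S_resolvent_poly q A \<circ> B = id"
    by (auto simp: S_spectrum_def)
  then show "surj (S_resolvent_poly q A)"
    by (metis comp_apply id_apply surjI)
  interpret B: bounded_right_linear B by fact
  obtain K where K: "K > 0" "\<And>x. norm (B x) \<le> norm x * K"
    using B.pos_bounded by blast
  have "1 / K * norm x \<le> norm (S_resolvent_poly q A x)" for x
    using K(1) K(2)[of "S_resolvent_poly q A x"] fun_cong[OF B(2), of x]
    by (simp add: field_simps)
  then show "\<exists>c>0. \<forall>x. c * norm x \<le> norm (S_resolvent_poly q A x)"
    using K(1) by (intro exI[of _ "1 / K"]) simp
qed

text \<open>
  Around a boundary point there are points \<open>s\<close> of the S-spectrum and points \<open>t\<close> outside it.  If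
  \<open>R\<^sub>q(A)\<close> had the lower bound \<open>c\<close>, then for \<open>s\<close> and \<open>t\<close> close enough to \<open>q\<close> both
  \<open>R\<^sub>s(A)\<close> and \<open>R\<^sub>t(A)\<close> would have the lower bound \<open>3c/4\<close> and differ by at most \<open>c/2\<close>, so
  that the surjectivity of \<open>R\<^sub>t(A)\<close> would pass to \<open>R\<^sub>s(A)\<close>.
\<close>

lemma frontier_S_spectrum_subset:
  assumes A: "bounded_right_linear A"
  shows "frontier (S_spectrum A) \<subseteq> approx_S_point_spectrum A"
proof (rule subsetI, rule ccontr)
  fix q assume q: "q \<in> frontier (S_spectrum A)" "q \<notin> approx_S_point_spectrum A"
  let ?R = "\<lambda>q. S_resolvent_poly q A"
  obtain c where c: "c > 0" "\<And>x. c * norm x \<le> norm (?R q x)"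
    using q(2) not_in_approx_S_point_spectrum_iff[OF A] by auto
  have "\<forall>\<^sub>F p in nhds q. \<forall>x. norm (?R p x - ?R q x) \<le> c / 4 * norm x"
    using c by (intro S_resolvent_poly_continuous A) simp
  then obtain \<delta> where "\<delta> > 0"
    and \<delta>: "\<And>p x. dist p q < \<delta> \<Longrightarrow> norm (?R p x - ?R q x) \<le> c / 4 * norm x"
    unfolding eventually_nhds_metric by blast
  obtain s t where s: "s \<in> S_spectrum A" "dist s q < \<delta>" and t: "t \<notin> S_spectrum A" "dist t q < \<delta>"
    using q(1) \<open>\<delta> > 0\<close> unfolding frontier_straddle by (metis dist_commute)
  have below: "(c - c / 4) * norm x \<le> norm (?R p x)" if "dist p q < \<delta>" for p x
    using bounded_below_perturbation[OF c(2) \<delta>[OF that]] .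
  have lin: "linear (?R p)" for p
    using bounded_right_linear_S_resolvent_poly[OF A]
    by (metis bounded_right_linear.axioms(1) bounded_linear.linear)
  have "norm (?R s x - ?R t x) \<le> c / 2 * norm x" for x
    using norm_diff_triangle_ineq[of "?R s x" "- ?R q x" "?R t x" "- ?R q x"]
      \<delta>[OF s(2), of x] \<delta>[OF t(2), of x]
      norm_triangle_ineq4[of "?R s x - ?R q x" "?R t x - ?R q x"] by simp
  then have "surj (?R s)"
    using c(1) below[OF t(2)]
    by (intro surj_perturbation[OF lin lin not_in_S_spectrumD(1)[OF t(1)], where c = "c - c / 4" and d = "c / 2"])
      simp_all
  then have "s \<notin> S_spectrum A"
    using c(1) below[OF s(2)] by (intro not_in_S_spectrumI[OF A, where c = "c - c / 4"]) simp_all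
  with s(1) show False by simp
qed

text \<open>
  For real \<open>r\<close> the operator \<open>R\<^sub>r(A)\<close> differs from the multiple \<open>r\<^sup>2\<close> of the identity by
  \<open>A\<^sup>2 - 2 r A\<close>, whose norm is at most \<open>K\<^sup>2 + 2 r K\<close> when \<open>K\<close> bounds \<open>A\<close>.  The choice
  \<open>r = 3 K\<close> makes this \<open>7 K\<^sup>2 < 9 K\<^sup>2\<close>.
\<close>

lemma S_spectrum_neq_UNIV:
  assumes A: "bounded_right_linear A"
  shows "S_spectrum A \<noteq> UNIV"
proof -
  interpret A: bounded_right_linear A by fact
  obtain K where K: "K > 0" "norm (A x) \<le> norm x * K" for x
    using A.pos_bounded by blast
  define r where "r = 3 * K"
  define q :: quat where "q = of_real r"
  have R: "S_resolvent_poly q A x = A (A x) - (2 * r) *\<^sub>R A x + r\<^sup>2 *\<^sub>R x" for x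
    by (simp add: S_resolvent_poly_def q_def) (simp add: of_real_def)
  have close: "norm (S_resolvent_poly q A x - r\<^sup>2 *\<^sub>R x) \<le> 7 * K\<^sup>2 * norm x" for x
  proof -
    have "norm (S_resolvent_poly q A x - r\<^sup>2 *\<^sub>R x) \<le> norm (A (A x)) + 6 * K * norm (A x)"
      using norm_triangle_ineq4[of "A (A x)" "(2 * r) *\<^sub>R A x"] K(1) by (simp add: R r_def)
    also have "\<dots> \<le> norm (A x) * K + 6 * K * norm (A x)"
      by (intro add_right_mono K)
    also have "\<dots> = 7 * K * norm (A x)"
      by simp
    also have "\<dots> \<le> 7 * K * (norm x * K)"
      using K by (intro mult_left_mono) simp_all
    finally show ?thesis
      by (simp add: power2_eq_square mult_ac)
  qed
  have below: "r\<^sup>2 * norm x \<le> norm (r\<^sup>2 *\<^sub>R x)" for x :: 'a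
    by simp
  have less: "7 * K\<^sup>2 < r\<^sup>2"
    using K(1) by (simp add: r_def power_mult_distrib)
  have "surj (S_resolvent_poly q A)"
  proof (rule surj_perturbation[OF _ _ _ below close _ less])
    show "linear (S_resolvent_poly q A)"
      using bounded_right_linear_S_resolvent_poly[OF A]
      by (metis bounded_right_linear.axioms(1) bounded_linear.linear)
    show "surj (\<lambda>x::'a. r\<^sup>2 *\<^sub>R x)"
      using K(1) by (intro surjI[of _ "\<lambda>x. x /\<^sub>R r\<^sup>2"]) (simp add: r_def)
  qed (simp_all add: bounded_linear.linear bounded_linear_scaleR_right)
  moreover have "(r\<^sup>2 - 7 * K\<^sup>2) * norm x \<le> norm (S_resolvent_poly q A x)" for x
    by (rule bounded_below_perturbation[OF below close])
  ultimately have "q \<notin> S_spectrum A"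
    using less by (intro not_in_S_spectrumI[OF A, where c = "r\<^sup>2 - 7 * K\<^sup>2"]) simp_all
  then show ?thesis by blast
qed

section \<open>The S-spectrum is non-empty\<close>

definition quat_of_complex :: "complex \<Rightarrow> quat" where
  "quat_of_complex z = Quat (Re z) (Im z) 0 0"

text \<open>
  The first component of \<open>p\<close> in the decomposition of the quaternions as \<open>\<complex> \<oplus> \<^bold>j\<complex>\<close>.  Both
  summands are stable under right multiplication by \<open>\<complex>\<close>, which is why this projection is
  right \<open>\<complex>\<close>-linear and turns \<open>qinner\<close> into a complex inner product.
\<close>

definition complex_part :: "quat \<Rightarrow> complex" where
  "complex_part p = Complex (qRe p) (qIm1 p)"

lemma quat_of_complex_mult: "quat_of_complex (z * w) = quat_of_complex z * quat_of_complex w"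
  by (simp add: quat_of_complex_def quat_eq_iff)

lemma quat_of_complex_diff: "quat_of_complex (z - w) = quat_of_complex z - quat_of_complex w"
  by (simp add: quat_of_complex_def quat_eq_iff)

lemma norm_quat_of_complex: "norm (quat_of_complex z) = norm z"
  by (simp add: quat_of_complex_def norm_quat_def cmod_def)

lemma complex_part_mult: "complex_part (p * quat_of_complex z) = complex_part p * z"
  by (simp add: complex_part_def quat_of_complex_def complex_eq_iff)

lemma bounded_linear_complex_part: "bounded_linear complex_part"
proof (rule bounded_linear_intro)
  show "norm (complex_part p) \<le> norm p * 1" for p
    by (simp add: complex_part_def norm_quat_def cmod_def)
qed (simp_all add: complex_part_def complex_eq_iff)

text \<open>
  The operator \<open>A - z\<close> of the complex Hilbert space obtained by restricting the scalars to \<open>\<complex>\<close>.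
  It is right linear over \<open>\<complex>\<close> but in general not over the quaternions, because right
  multiplication by \<open>z\<close> only commutes with scalars that commute with \<open>z\<close>.
\<close>

definition complex_pencil :: "('v \<Rightarrow> 'v) \<Rightarrow> complex \<Rightarrow> 'v \<Rightarrow> 'v::right_quat_hilbert" where
  "complex_pencil A z x = A x - x \<cdot>\<^sub>q quat_of_complex z"

lemma linear_complex_pencil:
  assumes "bounded_right_linear A"
  shows "linear (complex_pencil A z)"
proof -
  interpret A: bounded_right_linear A by fact
  show ?thesis
    unfolding complex_pencil_def
    by (intro bounded_linear.linear bounded_linear_sub A.bounded_linear_axioms bounded_linear_qscale)
qed

lemma complex_pencil_qscale:
  assumes "bounded_right_linear A"
  shows "complex_pencil A z (x \<cdot>\<^sub>q quat_of_complex w) = complex_pencil A z x \<cdot>\<^sub>q quat_of_complex w"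
proof -
  interpret A: bounded_right_linear A by fact
  have "quat_of_complex w * quat_of_complex z = quat_of_complex z * quat_of_complex w"
    by (metis quat_of_complex_mult mult.commute)
  then show ?thesis
    by (simp add: complex_pencil_def A.qscale qscale_minus_left qscale_qscale)
qed

lemma complex_pencil_shift:
  "complex_pencil A z x = complex_pencil A w x + x \<cdot>\<^sub>q quat_of_complex (w - z)"
  by (simp add: complex_pencil_def quat_of_complex_diff qscale_minus_right)

text \<open>
  Over \<open>\<complex>\<close> the real polynomial \<open>X\<^sup>2 - 2 Re(z) X + |z|\<^sup>2\<close> has the roots \<open>z\<close> and \<open>cnj z\<close>.
\<close>

lemma S_resolvent_poly_factor:
  assumes "bounded_right_linear A"
  shows "S_resolvent_poly (quat_of_complex z) A x = complex_pencil A z (complex_pencil A (cnj z) x)"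
proof -
  interpret A: bounded_right_linear A by fact
  have sum: "y \<cdot>\<^sub>q quat_of_complex z + y \<cdot>\<^sub>q quat_of_complex (cnj z) = (2 * Re z) *\<^sub>R y" for y :: 'a
  proof -
    have "quat_of_complex z + quat_of_complex (cnj z) = of_real (2 * Re z)"
      by (simp add: quat_of_complex_def quat_eq_iff of_real_def)
    then show ?thesis
      by (metis qscale_add_right scaleR_eq_qscale)
  qed
  have prod: "x \<cdot>\<^sub>q quat_of_complex (cnj z) \<cdot>\<^sub>q quat_of_complex z = (norm z)\<^sup>2 *\<^sub>R x"
  proof -
    have "quat_of_complex (cnj z) * quat_of_complex z = of_real ((norm z)\<^sup>2)"
      by (simp add: quat_of_complex_def quat_eq_iff of_real_def cmod_power2) (simp add: power2_eq_square)
    then show ?thesis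
      by (simp only: qscale_qscale scaleR_eq_qscale)
  qed
  have "complex_pencil A z (complex_pencil A (cnj z) x) =
      A (A x) - (A x \<cdot>\<^sub>q quat_of_complex z + A x \<cdot>\<^sub>q quat_of_complex (cnj z))
      + x \<cdot>\<^sub>q quat_of_complex (cnj z) \<cdot>\<^sub>q quat_of_complex z"
    by (simp add: complex_pencil_def A.diff A.qscale qscale_minus_left)
  then show ?thesis
    unfolding sum prod by (simp add: S_resolvent_poly_def norm_quat_of_complex) (simp add: quat_of_complex_def)
qed

text \<open>
  In \<open>R\<^sub>z(A) = (A - z)(A - cnj z)\<close> the left factor inherits surjectivity.  In the factorisation
  with \<open>z\<close> and \<open>cnj z\<close> exchanged, \<open>A - z\<close> is the right factor, and it inherits the lower bound.
\<close>

lemma complex_pencil_invertible: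
  assumes A: "bounded_right_linear A"
    and z: "quat_of_complex z \<notin> S_spectrum A" "quat_of_complex (cnj z) \<notin> S_spectrum A"
  shows "surj (complex_pencil A z)"
    and "\<exists>c>0. \<forall>x. c * norm x \<le> norm (complex_pencil A z x)"
proof -
  interpret A: bounded_right_linear A by fact
  show "surj (complex_pencil A z)"
    using not_in_S_spectrumD(1)[OF z(1)] unfolding surj_def S_resolvent_poly_factor[OF A] by metis
  have bl: "bounded_linear (complex_pencil A (cnj z))"
    unfolding complex_pencil_def
    by (intro bounded_linear_sub A.bounded_linear_axioms bounded_linear_qscale)
  then obtain K where K: "K > 0" "\<And>x. norm (complex_pencil A (cnj z) x) \<le> norm x * K"
    using bounded_linear.pos_bounded by blast
  obtain c where c: "c > 0" "\<And>x. c * norm x \<le> norm (S_resolvent_poly (quat_of_complex (cnj z)) A x)"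
    using not_in_S_spectrumD(2)[OF z(2)] by blast
  have "c / K * norm x \<le> norm (complex_pencil A z x)" for x
    using order_trans[OF c(2)[of x, unfolded S_resolvent_poly_factor[OF A] complex_cnj_cnj] K(2)] K(1)
    by (simp add: field_simps)
  then show "\<exists>c>0. \<forall>x. c * norm x \<le> norm (complex_pencil A z x)"
    using c(1) K(1) by (intro exI[of _ "c / K"]) simp
qed

text \<open>
  The classical argument for operators on complex Banach spaces.  Write \<open>G z\<close> for the inverse of
  \<open>A - z\<close>.  The resolvent identity \<open>G w - G z = (w - z) G w G z\<close> makes
  \<open>z \<mapsto> \<langle>\<phi>, G z \<psi>\<rangle>\<close> an entire function with derivative \<open>\<langle>\<phi>, G z (G z \<psi>)\<rangle>\<close>, provided \<open>G\<close> is
  strongly continuous.  The function vanishes at infinity because \<open>norm (G z)\<close> is at most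
  \<open>1 / (norm z - K)\<close>, so it is identically zero.  Taking \<open>\<phi> = G 0 \<psi>\<close>, its value at \<open>0\<close> is
  \<open>(norm \<phi>)\<^sup>2\<close>, which forces \<open>\<psi> = 0\<close>.
\<close>

lemma S_spectrum_nonempty:
  fixes A :: "'v::right_quat_hilbert \<Rightarrow> 'v"
  assumes A: "bounded_right_linear A" and "(UNIV :: 'v set) \<noteq> {0}"
  shows "S_spectrum A \<noteq> {}"
proof
  assume empty: "S_spectrum A = {}"
  interpret A: bounded_right_linear A by fact
  let ?P = "complex_pencil A"
  have P_diff: "?P z (x - y) = ?P z x - ?P z y" for z x y
    using linear_complex_pencil[OF A] by (rule linear_diff)
  have surj: "surj (?P z)" and below: "\<exists>c>0. \<forall>x. c * norm x \<le> norm (?P z x)" for z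
    using complex_pencil_invertible[OF A] empty by auto
  have inj: "inj (?P z)" for z
    using below[of z] bounded_below_inj[OF linear_complex_pencil[OF A]] by blast
  define G where "G z = inv (?P z)" for z
  have PG: "?P z (G z u) = u" for z u
    unfolding G_def by (rule surj_f_inv_f[OF surj])
  have G_qscale: "G z (u \<cdot>\<^sub>q quat_of_complex w) = G z u \<cdot>\<^sub>q quat_of_complex w" for z u w
    by (rule injD[OF inj[of z]]) (simp add: PG complex_pencil_qscale[OF A])
  have resolvent: "G w u - G z u = G w (G z u) \<cdot>\<^sub>q quat_of_complex (w - z)" for w z u
  proof -
    have "?P w (G w u - G z u) = u - (?P z (G z u) + G z u \<cdot>\<^sub>q quat_of_complex (z - w))"
      by (simp add: P_diff PG complex_pencil_shift[of A w "G z u" z])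
    also have "\<dots> = G z u \<cdot>\<^sub>q quat_of_complex (w - z)"
      by (simp add: PG quat_of_complex_diff qscale_minus_right)
    also have "\<dots> = ?P w (G w (G z u \<cdot>\<^sub>q quat_of_complex (w - z)))"
      by (simp add: PG)
    finally show ?thesis
      unfolding G_qscale[symmetric] by (rule injD[OF inj])
  qed
  have G_cont: "isCont (\<lambda>w. G w u) z" for z u
  proof -
    obtain c where c: "c > 0" "\<And>x. c * norm x \<le> norm (?P z x)"
      using below by blast
    \<comment> \<open>Near \<open>z\<close> the lower bound of \<open>A - w\<close> is at least \<open>c / 2\<close>, so \<open>G w\<close> is locally bounded and
      the resolvent identity gives continuity.\<close>
    have "\<forall>\<^sub>F w in at z. dist w z < c / 2"
      unfolding eventually_at using c(1) by (intro exI[of _ "c / 2"]) simp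
    then have "\<forall>\<^sub>F w in at z. norm (G w u - G z u) \<le> 2 / c * norm (G z u) * norm (w - z)"
    proof (rule eventually_mono)
      fix w assume w: "dist w z < c / 2"
      have "norm (?P w x - ?P z x) \<le> c / 2 * norm x" for x
      proof -
        have "norm (?P w x - ?P z x) = dist w z * norm x"
          by (simp add: complex_pencil_shift[of A w x z] norm_qscale norm_quat_of_complex
              dist_norm norm_minus_commute)
        also have "\<dots> \<le> c / 2 * norm x"
          using w by (intro mult_right_mono) simp_all
        finally show ?thesis .
      qed
      then have "(c - c / 2) * norm (G w (G z u)) \<le> norm (?P w (G w (G z u)))"
        by (rule bounded_below_perturbation[OF c(2)])
      then have "norm (G w (G z u)) \<le> 2 / c * norm (G z u)"
        using c(1) by (simp add: PG field_simps)
      then show "norm (G w u - G z u) \<le> 2 / c * norm (G z u) * norm (w - z)"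
        unfolding resolvent norm_qscale norm_quat_of_complex by (intro mult_right_mono) simp_all
    qed
    moreover have "((\<lambda>w. 2 / c * norm (G z u) * norm (w - z)) \<longlongrightarrow> 0) (at z)"
      by (rule tendsto_eq_intros refl | simp)+
    ultimately have "((\<lambda>w. G w u - G z u) \<longlongrightarrow> 0) (at z)"
      by (rule Lim_null_comparison)
    then show ?thesis
      unfolding isCont_def by (simp add: LIM_zero_iff)
  qed
  obtain K where K: "K > 0" "\<And>x. norm (A x) \<le> norm x * K"
    using A.pos_bounded by blast
  have G_at_infinity: "((\<lambda>z. G z u) \<longlongrightarrow> 0) at_infinity" for u
  proof (rule Lim_null_comparison)
    show "\<forall>\<^sub>F z in at_infinity. norm (G z u) \<le> norm u / (norm z - K)"
    proof (unfold eventually_at_infinity, intro exI allI impI)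
      fix z :: complex assume "K + 1 \<le> norm z"
      then have z: "norm z - K > 0" by simp
      have "norm (G z u) * norm z = norm (A (G z u) - u)"
      proof -
        have "G z u \<cdot>\<^sub>q quat_of_complex z = A (G z u) - u"
          using PG[of z u] by (simp add: complex_pencil_def algebra_simps)
        then show ?thesis
          by (metis norm_qscale norm_quat_of_complex)
      qed
      also have "\<dots> \<le> norm (G z u) * K + norm u"
        using norm_triangle_ineq4[of "A (G z u)" u] K(2)[of "G z u"] by simp
      finally show "norm (G z u) \<le> norm u / (norm z - K)"
        using z by (simp add: field_simps)
    qed
    have "filterlim (\<lambda>z::complex. norm z - K) at_top at_infinity"
      using filterlim_tendsto_add_at_top[OF tendsto_const[of "- K"] filterlim_norm_at_top] by simp
    then show "((\<lambda>z::complex. norm u / (norm z - K)) \<longlongrightarrow> 0) at_infinity"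
      by (intro real_tendsto_divide_at_top[OF tendsto_const])
  qed
  obtain \<psi> :: 'v where "\<psi> \<noteq> 0"
    using \<open>UNIV \<noteq> {0}\<close> by auto
  define \<phi> where "\<phi> = G 0 \<psi>"
  define L where "L u = complex_part (qinner \<phi> u)" for u
  have L: "bounded_linear L"
    unfolding L_def by (intro bounded_linear_compose[OF bounded_linear_complex_part] bounded_linear_qinner)
  have L_qscale: "L (u \<cdot>\<^sub>q quat_of_complex z) = L u * z" for u z
    by (simp add: L_def qinner_qscale_right complex_part_mult)
  have "((\<lambda>w. L (G w \<psi>)) has_field_derivative L (G z (G z \<psi>))) (at z)" for z
    unfolding CARAT_DERIV
  proof (intro exI conjI allI)
    show "L (G w \<psi>) - L (G z \<psi>) = L (G w (G z \<psi>)) * (w - z)" for w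
      by (metis resolvent L_qscale bounded_linear.linear[OF L] linear_diff)
    show "isCont (\<lambda>w. L (G w (G z \<psi>))) z"
      by (intro bounded_linear.isCont[OF L] G_cont)
  qed simp
  then have "(\<lambda>z. L (G z \<psi>)) holomorphic_on UNIV"
    unfolding holomorphic_on_def field_differentiable_def by (auto intro: has_field_derivative_at_within)
  moreover have "((\<lambda>z. L (G z \<psi>)) \<longlongrightarrow> 0) at_infinity"
    using bounded_linear.tendsto[OF L G_at_infinity] linear_0[OF bounded_linear.linear[OF L]] by simp
  ultimately have "L (G 0 \<psi>) = 0"
    by (rule Liouville_weak)
  then have "complex_part (of_real ((norm \<phi>)\<^sup>2)) = 0"
    by (simp only: L_def \<phi>_def[symmetric] qinner_self)
  then have "\<phi> = 0"
    by (simp add: complex_part_def complex_eq_iff of_real_def)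
  then have "\<psi> = 0"
    using PG[of 0 \<psi>] linear_0[OF linear_complex_pencil[OF A]] by (simp add: \<phi>_def)
  with \<open>\<psi> \<noteq> 0\<close> show False ..
qed

theorem theorem5p4:
  fixes A :: "'v::right_quat_hilbert \<Rightarrow> 'v"
  assumes "(UNIV :: 'v set) \<noteq> {0}"
    and "separable_space (euclidean :: 'v topology)"
    and "bounded_right_linear A"
  shows "approx_S_point_spectrum A \<noteq> {}
    \<and> closed (approx_S_point_spectrum A)
    \<and> frontier (S_spectrum A) \<subseteq> approx_S_point_spectrum A"
proof -
  have "frontier (S_spectrum A) \<noteq> {}"
    using S_spectrum_nonempty[OF assms(3,1)] S_spectrum_neq_UNIV[OF assms(3)]
    by (simp add: frontier_eq_empty)
  then show ?thesis
    using frontier_S_spectrum_subset[OF assms(3)] closed_approx_S_point_spectrum[OF assms(3)] by blast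
qed

end
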